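(* Let $R\in\{\mathbb{Z},\mathbb{Z}[\varphi]\}$ and let $\mathcal{O}$ be an $R$-order in a real composition algebra $A$. If $\mathcal{S}_1(\mathcal{O})$ is a root-shell system over $R$, then the axis shell $\mathcal{A}(\mathcal{O})=(\mathcal{S}_1(\mathcal{O})\times\{0\})\cup(\{0\}\times\mathcal{S}_1(\mathcal{O}))$ is a root-shell system over $R$ of type $\mathcal{S}_1(\mathcal{O})\oplus\mathcal{S}_1(\mathcal{O})$, the orthogonal direct sum.
   Context: $\varphi=(1+\sqrt5)/2$. $A$ is one of $\mathbb{R},\mathbb{C},\mathbb{H},\mathbb{O}$ with its standard positive definite multiplicative norm $N$, polar form $B(x,y)=N(x+y)-N(x)-N(y)=x\bar y+y\bar x$ and conjugation $\bar x=B(x,1)\cdot1-x$; it is a Euclidean space with $\langle x,y\rangle=\tfrac12B(x,y)$. An $R$-order in $A$ is a finitely generated $R$-submodule $\mathcal{O}\subset A$ with $1\in\mathcal{O}$, $\overline{\mathcal{O}}=\mathcal{O}$, $\mathcal{O}\cdot\mathcal{O}\subseteq\mathcal{O}$, $N(\mathcal{O})\subseteq R$, and $B$ restricting to an $R$-bilinear map $\mathcal{O}\times\mathcal{O}\to R$. $\mathcal{S}_1(\mathcal{O})=\{x\in\mathcal{O}:N(x)=1\}$. $A^2$ carries the quadratic form $Q(x,y)=N(x)+N(y)$ with polar form $B_Q((x,y),(x',y'))=B(x,x')+B(y,y')$, and the corresponding Euclidean structure. A root-shell system over $R$ is a finite subset $T$ of a Euclidean space $V$ such that (R1) $T=-T$;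 (R2) $T$ is contained in a single sphere $\{x\in V: \mathcal N(x)=1\}$ for the Euclidean (squared) norm $\mathcal N$, so all elements have the same length; (R3) for every $\alpha\in T$ the reflection $r_\alpha(x)=x-\frac{2\langle x,\alpha\rangle}{\langle\alpha,\alpha\rangle}\alpha$ preserves $T$; (R4) the Cartan coefficients $\frac{2\langle\alpha,\beta\rangle}{\langle\alpha,\alpha\rangle}$ lie in $R$ for all $\alpha,\beta\in T$. The orthogonal direct sum of $T_1\subset V_1$ and $T_2\subset V_2$ is $(T_1\times\{0\})\cup(\{0\}\times T_2)\subset V_1\oplus V_2$ with $V_1\perp V_2$. *)

theory Defs
  imports "HOL-Analysis.Analysis"
begin

section \<open>The scalar ring \<open>\<int>[\<phi>]\<close>\<close>

definition golden_ratio :: real (\<open>\<phi>\<close>) where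
  "\<phi> = (1 + sqrt 5) / 2"

text \<open>As \<open>\<phi>\<^sup>2 = \<phi> + 1\<close>, the subring of \<open>\<real>\<close> generated by \<open>\<phi>\<close> is \<open>\<int> + \<int>\<phi>\<close>.\<close>

definition golden_integers :: "real set" (\<open>\<int>[\<phi>]\<close>) where
  "\<int>[\<phi>] = {of_int a + of_int b * \<phi> | a b :: int. True}"

lemma golden_ratio_square: "\<phi> * \<phi> = \<phi> + 1"
  by (simp add: golden_ratio_def field_simps)

lemma golden_integers_mult:
  assumes "x \<in> \<int>[\<phi>]" "y \<in> \<int>[\<phi>]"
  shows "x * y \<in> \<int>[\<phi>]"
proof -
  obtain a b c d :: int where x: "x = of_int a + of_int b * \<phi>" and y: "y = of_int c + of_int d * \<phi>"
    using assms by (auto simp: golden_integers_def)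
  have "x * y = of_int a * of_int c + (of_int a * of_int d + of_int b * of_int c) * \<phi>
      + of_int b * of_int d * (\<phi> * \<phi>)"
    by (simp add: x y algebra_simps)
  also have "\<dots> = of_int (a * c + b * d) + of_int (a * d + b * c + b * d) * \<phi>"
    by (simp only: golden_ratio_square) (simp add: algebra_simps)
  finally show ?thesis
    unfolding golden_integers_def by blast
qed


section \<open>Norm form and polar form of a Euclidean space\<close>

definition sq_norm :: "'v::euclidean_space \<Rightarrow> real" where
  "sq_norm x = x \<bullet> x"

definition polar :: "'v::euclidean_space \<Rightarrow> 'v \<Rightarrow> real" where
  "polar x y = sq_norm (x + y) - sq_norm x - sq_norm y"

lemma inner_eq_half_polar: "x \<bullet> y = polar x y / 2"
  by (simp add: polar_def sq_norm_def inner_add inner_commute)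

text \<open>The library's Euclidean structure on a product is the one given by
  \<open>Q(x, y) = N(x) + N(y)\<close>; in particular the two factors are orthogonal.\<close>

lemma sq_norm_Pair: "sq_norm (x, y) = sq_norm x + sq_norm y"
  by (simp add: sq_norm_def inner_Pair)

lemma polar_Pair: "polar (x, y) (x', y') = polar x x' + polar y y'"
  by (simp add: polar_def sq_norm_Pair)

lemma factors_orthogonal:
  "((x :: 'v::euclidean_space), 0 :: 'w::euclidean_space) \<bullet> (0, y) = 0"
  by (simp add: inner_Pair)


section \<open>The algebras \<open>\<real>\<close>, \<open>\<complex>\<close>, \<open>\<bbbH>\<close>, \<open>\<bbbO>\<close>\<close>

text \<open>The vector space and norm form of an algebra come from its carrier type.\<close>

record 'a unital_algebra =
  mul :: "'a \<Rightarrow> 'a \<Rightarrow> 'a"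
  unit :: 'a

definition cnjg :: "'a::euclidean_space unital_algebra \<Rightarrow> 'a \<Rightarrow> 'a" where
  "cnjg A x = polar x (unit A) *\<^sub>R unit A - x"

text \<open>Cayley--Dickson doubling: \<open>(a, b)(c, d) = (ac - d\<^sup>* b, da + bc\<^sup>*)\<close>.\<close>

definition cayley_dickson ::
  "'a::euclidean_space unital_algebra \<Rightarrow> ('a \<times> 'a) unital_algebra" where
  "cayley_dickson A =
    \<lparr> mul = (\<lambda>(a, b) (c, d).
        (mul A a c - mul A (cnjg A d) b, mul A d a + mul A b (cnjg A c))),
      unit = (unit A, 0) \<rparr>"

type_synonym quaternion = "complex \<times> complex"
type_synonym octonion = "quaternion \<times> quaternion"

definition real_algebra :: "real unital_algebra" where
  "real_algebra = \<lparr> mul = (*), unit = 1 \<rparr>"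

definition complex_algebra :: "complex unital_algebra" where
  "complex_algebra = \<lparr> mul = (*), unit = 1 \<rparr>"

definition quaternion_algebra :: "quaternion unital_algebra" where
  "quaternion_algebra = cayley_dickson complex_algebra"

definition octonion_algebra :: "octonion unital_algebra" where
  "octonion_algebra = cayley_dickson quaternion_algebra"

lemma cnjg_real: "cnjg real_algebra x = x"
  by (simp add: cnjg_def real_algebra_def polar_def sq_norm_def algebra_simps)

lemma cnjg_complex: "cnjg complex_algebra z = cnj z"
  by (simp add: cnjg_def complex_algebra_def polar_def sq_norm_def inner_complex_def
      complex_eq_iff algebra_simps)

lemma cnjg_cayley_dickson: "cnjg (cayley_dickson A) (a, b) = (cnjg A a, - b)"
  by (simp add: cnjg_def cayley_dickson_def polar_Pair)
    (simp add: polar_def sq_norm_def)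

lemma mul_quaternion:
  "mul quaternion_algebra (a, b) (c, d) = (a * c - cnj d * b, d * a + b * cnj c)"
  unfolding quaternion_algebra_def cayley_dickson_def unital_algebra.simps prod.case cnjg_complex
  by (simp add: complex_algebra_def)

lemma cnjg_quaternion: "cnjg quaternion_algebra (a, b) = (cnj a, - b)"
  by (simp add: quaternion_algebra_def cnjg_cayley_dickson cnjg_complex)

lemma sq_norm_mul_real:
  "sq_norm (mul real_algebra x y) = sq_norm x * sq_norm y"
  by (simp add: real_algebra_def sq_norm_def)

lemma sq_norm_mul_complex:
  "sq_norm (mul complex_algebra x y) = sq_norm x * sq_norm y"
  by (simp add: complex_algebra_def sq_norm_def dot_square_norm norm_mult power_mult_distrib)

lemma sq_norm_mul_quaternion:
  "sq_norm (mul quaternion_algebra x y) = sq_norm x * sq_norm y"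
  by (cases x; cases y)
    (simp add: mul_quaternion sq_norm_def inner_Pair inner_complex_def algebra_simps)

lemma sq_norm_mul_octonion:
  "sq_norm (mul octonion_algebra x y) = sq_norm x * sq_norm y"
proof -
  obtain a b c d where x: "x = ((a, b), (c, d))" by (metis surj_pair)
  obtain a' b' c' d' where y: "y = ((a', b'), (c', d'))" by (metis surj_pair)
  have "mul octonion_algebra x y =
      (mul quaternion_algebra (a, b) (a', b') - mul quaternion_algebra (cnj c', - d') (c, d),
       mul quaternion_algebra (c', d') (a, b) + mul quaternion_algebra (c, d) (cnj a', - b'))"
    by (simp add: x y octonion_algebra_def cayley_dickson_def cnjg_quaternion)
  then show ?thesis
    by (simp add: x y mul_quaternion sq_norm_def inner_Pair inner_complex_def algebra_simps)
qed


section \<open>Orders\<close>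

definition finitely_generated_submodule :: "real set \<Rightarrow> 'v::real_vector set \<Rightarrow> bool" where
  "finitely_generated_submodule R M \<longleftrightarrow>
    (\<exists>G. finite G \<and> M = {\<Sum>g\<in>G. c g *\<^sub>R g | c. \<forall>g\<in>G. c g \<in> R})"

definition bilinear_over :: "real set \<Rightarrow> 'v::real_vector set \<Rightarrow> ('v \<Rightarrow> 'v \<Rightarrow> real) \<Rightarrow> bool" where
  "bilinear_over R M f \<longleftrightarrow>
    (\<forall>x\<in>M. \<forall>y\<in>M. f x y \<in> R) \<and>
    (\<forall>x\<in>M. \<forall>y\<in>M. \<forall>z\<in>M. f (x + y) z = f x z + f y z \<and> f z (x + y) = f z x + f z y) \<and>
    (\<forall>r\<in>R. \<forall>x\<in>M. \<forall>y\<in>M. f (r *\<^sub>R x) y = r * f x y \<and> f x (r *\<^sub>R y) = r * f x y)"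

definition is_order ::
  "real set \<Rightarrow> 'a::euclidean_space unital_algebra \<Rightarrow> 'a set \<Rightarrow> bool" where
  "is_order R A \<O> \<longleftrightarrow>
    finitely_generated_submodule R \<O> \<and>
    unit A \<in> \<O> \<and>
    cnjg A ` \<O> = \<O> \<and>
    (\<forall>x\<in>\<O>. \<forall>y\<in>\<O>. mul A x y \<in> \<O>) \<and>
    sq_norm ` \<O> \<subseteq> R \<and>
    bilinear_over R \<O> polar"

definition unit_shell :: "'a::euclidean_space set \<Rightarrow> 'a set" where
  "unit_shell \<O> = {x \<in> \<O>. sq_norm x = 1}"

definition axis_shell :: "'a::euclidean_space set \<Rightarrow> ('a \<times> 'a) set" where
  "axis_shell \<O> = (unit_shell \<O> \<times> {0}) \<union> ({0} \<times> unit_shell \<O>)"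


section \<open>Root-shell systems\<close>

definition reflection :: "'v::euclidean_space \<Rightarrow> 'v \<Rightarrow> 'v" where
  "reflection \<alpha> x = x - (2 * (x \<bullet> \<alpha>) / (\<alpha> \<bullet> \<alpha>)) *\<^sub>R \<alpha>"

definition root_shell_system :: "real set \<Rightarrow> 'v::euclidean_space set \<Rightarrow> bool" where
  "root_shell_system R T \<longleftrightarrow>
    finite T \<and>
    T = uminus ` T \<and>
    T \<subseteq> {x. sq_norm x = 1} \<and>
    (\<forall>\<alpha>\<in>T. reflection \<alpha> ` T = T) \<and>
    (\<forall>\<alpha>\<in>T. \<forall>\<beta>\<in>T. 2 * (\<alpha> \<bullet> \<beta>) / (\<alpha> \<bullet> \<alpha>) \<in> R)"

definition orthogonal_direct_sum ::
  "'v::euclidean_space set \<Rightarrow> 'w::euclidean_space set \<Rightarrow> ('v \<times> 'w) set" where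
  "orthogonal_direct_sum T\<^sub>1 T\<^sub>2 = (T\<^sub>1 \<times> {0}) \<union> ({0} \<times> T\<^sub>2)"

end

theory Submission
  imports Defs
begin

text \<open>
  The orthogonal direct sum of any two root-shell systems over \<open>R\<close> is again one, as soon as
  \<open>0 \<in> R\<close>. Indeed, a root \<open>\<alpha>\<close> of one summand is orthogonal to the other summand, so its
  reflection acts as before on its own summand and fixes the other one pointwise; and the Cartan
  coefficient of two roots is either that of a single summand or, for roots of different summands,
  \<open>0\<close>. Both \<open>\<int>\<close> and \<open>\<int>[\<phi>]\<close> contain \<open>0\<close>.

  The axis shell is by construction the orthogonal direct sum of two copies of the unit shell, so
  for each of the four algebras the claim is the case in which both summands are that shell.
\<close>

lemma reflection_Pair_left: "reflection (\<alpha>, 0) (x, y) = (reflection \<alpha> x, y)"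
  by (simp add: reflection_def)

lemma reflection_Pair_right: "reflection (0, \<alpha>) (x, y) = (x, reflection \<alpha> y)"
  by (simp add: reflection_def)

lemma reflection_zero: "reflection \<alpha> 0 = 0"
  by (simp add: reflection_def)

lemma reflection_image_orthogonal_direct_sum_left:
  "reflection (\<alpha>, 0) ` orthogonal_direct_sum S T = orthogonal_direct_sum (reflection \<alpha> ` S) T"
  unfolding orthogonal_direct_sum_def
  by (force simp: image_Un image_iff reflection_Pair_left reflection_zero)

lemma reflection_image_orthogonal_direct_sum_right:
  "reflection (0, \<alpha>) ` orthogonal_direct_sum S T = orthogonal_direct_sum S (reflection \<alpha> ` T)"
  unfolding orthogonal_direct_sum_def
  by (force simp: image_Un image_iff reflection_Pair_right reflection_zero)

lemma uminus_image_orthogonal_direct_sum: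
  "uminus ` orthogonal_direct_sum S T = orthogonal_direct_sum (uminus ` S) (uminus ` T)"
  unfolding orthogonal_direct_sum_def by (force simp: image_Un image_iff)

text \<open>
  Each summand is orthogonal to the roots of the other one and hence fixed by their reflections.
  The scalar \<open>0\<close> occurs as the Cartan coefficient of two roots from different summands.
\<close>

lemma root_shell_system_orthogonal_direct_sum:
  assumes "0 \<in> R" and S: "root_shell_system R S" and T: "root_shell_system R T"
  shows "root_shell_system R (orthogonal_direct_sum S T)"
  unfolding root_shell_system_def
proof (intro conjI ballI)
  let ?U = "orthogonal_direct_sum S T"
  show "finite ?U"
    using S T by (simp add: root_shell_system_def orthogonal_direct_sum_def)
  show "?U = uminus ` ?U"
    using S T by (simp add: root_shell_system_def uminus_image_orthogonal_direct_sum)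
  show "?U \<subseteq> {x. sq_norm x = 1}"
    using S T
    by (auto simp: root_shell_system_def orthogonal_direct_sum_def sq_norm_def)
  fix \<gamma> assume \<gamma>: "\<gamma> \<in> ?U"
  then consider (left) \<alpha> where "\<gamma> = (\<alpha>, 0)" "\<alpha> \<in> S" | (right) \<alpha> where "\<gamma> = (0, \<alpha>)" "\<alpha> \<in> T"
    by (auto simp: orthogonal_direct_sum_def)
  then show "reflection \<gamma> ` ?U = ?U"
  proof cases
    case left
    then show ?thesis
      using S by (simp add: root_shell_system_def reflection_image_orthogonal_direct_sum_left)
  next
    case right
    then show ?thesis
      using T by (simp add: root_shell_system_def reflection_image_orthogonal_direct_sum_right)
  qed
  fix \<delta> assume "\<delta> \<in> ?U"
  then show "2 * (\<gamma> \<bullet> \<delta>) / (\<gamma> \<bullet> \<gamma>) \<in> R"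
    using \<gamma> S T \<open>0 \<in> R\<close>
    by (auto simp: root_shell_system_def orthogonal_direct_sum_def)
qed

lemma axis_shell_eq_orthogonal_direct_sum:
  "axis_shell \<O> = orthogonal_direct_sum (unit_shell \<O>) (unit_shell \<O>)"
  by (simp add: axis_shell_def orthogonal_direct_sum_def)

theorem proposition3p8:
  fixes R :: "real set"
  assumes "R \<in> {\<int>, \<int>[\<phi>]}"
  shows
    "(\<forall>\<O> :: real set.
        is_order R real_algebra \<O> \<longrightarrow> root_shell_system R (unit_shell \<O>) \<longrightarrow>
        root_shell_system R (axis_shell \<O>) \<and>
        axis_shell \<O> = orthogonal_direct_sum (unit_shell \<O>) (unit_shell \<O>)) \<and>
     (\<forall>\<O> :: complex set.
        is_order R complex_algebra \<O> \<longrightarrow> root_shell_system R (unit_shell \<O>) \<longrightarrow>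
        root_shell_system R (axis_shell \<O>) \<and>
        axis_shell \<O> = orthogonal_direct_sum (unit_shell \<O>) (unit_shell \<O>)) \<and>
     (\<forall>\<O> :: quaternion set.
        is_order R quaternion_algebra \<O> \<longrightarrow> root_shell_system R (unit_shell \<O>) \<longrightarrow>
        root_shell_system R (axis_shell \<O>) \<and>
        axis_shell \<O> = orthogonal_direct_sum (unit_shell \<O>) (unit_shell \<O>)) \<and>
     (\<forall>\<O> :: octonion set.
        is_order R octonion_algebra \<O> \<longrightarrow> root_shell_system R (unit_shell \<O>) \<longrightarrow>
        root_shell_system R (axis_shell \<O>) \<and>
        axis_shell \<O> = orthogonal_direct_sum (unit_shell \<O>) (unit_shell \<O>))"
proof -
  have "0 \<in> \<int>[\<phi>]"
    unfolding golden_integers_def by (auto intro!: exI[of _ 0])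
  then have "0 \<in> R"
    using assms by auto
  then show ?thesis
    by (simp add: axis_shell_eq_orthogonal_direct_sum root_shell_system_orthogonal_direct_sum)
qed

end
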